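(* Let $F$ be the face $(U_{3,4},U_{1,4})$ of $\Gamma_4$. For real $a,b\ge0$, the point $\mathbf h=(a,b)\in F$ is entropic if and only if either $a\ge0$ and $b>0$, or $(a,b)=(\log v,0)$ for some positive integer $v$.
   Context: $N_4=\{1,2,3,4\}$. $\Gamma_4$ is the cone of all polymatroid rank functions on $N_4$. A set function $\mathbf h:2^{N_4}\to\mathbb R$ is called entropic if there is a random vector $(X_1,X_2,X_3,X_4)$, each $X_i$ taking values in a finite set, with $\mathbf h(A)=H(X_A)$ for all $A\subseteq N_4$, where $H$ is Shannon entropy, $X_A=(X_j,j\in A)$ and $\mathbf h(\emptyset)=0$. Logarithms (also in the entropy) are to base $2$. For two (poly)matroids $M_1,M_2$ on $N_4$ with rank functions $\mathbf r_1,\mathbf r_2$, $(M_1,M_2)$ denotes the face $\{a\mathbf r_1+b\mathbf r_2:a,b\ge0\}$ of $\Gamma_4$, and $(a,b)$ denotes the point $a\mathbf r_1+b\mathbf r_2$. $U_{k,4}$ is the uniform matroid on $N_4$ with rank function $\mathbf r(A)=\min\{k,|A|\}$. *)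

theory Defs
  imports "HOL-Probability.Probability"
begin

text \<open>
  The ground set \<open>N\<^sub>4 = {1,2,3,4}\<close> is the four-element type \<^typ>\<open>4\<close> (in which \<open>4 = 0\<close>), so that
  \<open>{1,2,3,4} = UNIV\<close> and a set function on \<open>N\<^sub>4\<close> is a vector in \<^typ>\<open>real ^ (4 set)\<close>.
\<close>

lemma ground_set: "(UNIV :: 4 set) = {1, 2, 3, 4}"
  using exhaust_4 by auto

definition Gamma4 :: "(real ^ (4 set)) set" where
  "Gamma4 = {h. h $ {} = 0 \<and> (\<forall>A B. A \<subseteq> B \<longrightarrow> h $ A \<le> h $ B) \<and>
    (\<forall>A B. h $ (A \<union> B) + h $ (A \<inter> B) \<le> h $ A + h $ B)}"

definition uniform_rank :: "nat \<Rightarrow> real ^ (4 set)" where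
  "uniform_rank k = (\<chi> A. real (min k (card A)))"

definition pair_point :: "real ^ (4 set) \<Rightarrow> real ^ (4 set) \<Rightarrow> real \<Rightarrow> real \<Rightarrow> real ^ (4 set)" where
  "pair_point r1 r2 a b = a *\<^sub>R r1 + b *\<^sub>R r2"

definition pair_face :: "real ^ (4 set) \<Rightarrow> real ^ (4 set) \<Rightarrow> (real ^ (4 set)) set" where
  "pair_face r1 r2 = {pair_point r1 r2 a b | a b. 0 \<le> a \<and> 0 \<le> b}"

definition subvector :: "(4 \<Rightarrow> 'w \<Rightarrow> 'v) \<Rightarrow> 4 set \<Rightarrow> 'w \<Rightarrow> (4 \<Rightarrow> 'v)" where
  "subvector X A = (\<lambda>\<omega>. restrict (\<lambda>i. X i \<omega>) A)"

text \<open>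
  The entropy below is the library's \<open>\<H>(X)\<close> for base 2; that abbreviation is only available
  inside the locale \<^locale>\<open>information_space\<close>.
\<close>

definition joint_entropy :: "'w measure \<Rightarrow> (4 \<Rightarrow> 'w \<Rightarrow> 'v) \<Rightarrow> 4 set \<Rightarrow> real" where
  "joint_entropy M X A =
    prob_space.entropy M 2 (count_space (subvector X A ` space M)) (subvector X A)"

definition entropy_vector_of :: "'w measure \<Rightarrow> (4 \<Rightarrow> 'w \<Rightarrow> 'v) \<Rightarrow> real ^ (4 set) \<Rightarrow> bool" where
  "entropy_vector_of M X h \<longleftrightarrow>
    prob_space M \<and> (\<forall>i. simple_function M (X i)) \<and> (\<forall>A. h $ A = joint_entropy M X A)"

text \<open>
  HOL cannot quantify over the type of the sample space inside a definition. Fixing it to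
  \<^typ>\<open>4 \<Rightarrow> nat\<close>, with values in \<^typ>\<open>nat\<close>, loses nothing: see \<open>entropic_if_entropy_vector_of\<close>.
\<close>

definition entropic :: "real ^ (4 set) \<Rightarrow> bool" where
  "entropic h \<longleftrightarrow>
    (\<exists>(M :: (4 \<Rightarrow> nat) measure) (X :: 4 \<Rightarrow> (4 \<Rightarrow> nat) \<Rightarrow> nat). entropy_vector_of M X h)"

lemma simple_function_subvector:
  assumes "\<And>i. simple_function M (X i)"
  shows "simple_function M (subvector X A)"
proof -
  have fin: "finite (subvector X A ` space M)"
  proof (rule finite_subset)
    show "subvector X A ` space M \<subseteq> (\<Pi>\<^sub>E i\<in>A. X i ` space M)"
      by (auto simp: subvector_def)
    show "finite (\<Pi>\<^sub>E i\<in>A. X i ` space M)"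
      using assms by (intro finite_PiE) (auto simp: simple_function_def)
  qed
  have meas: "subvector X A -` {x} \<inter> space M \<in> sets M" if "x \<in> subvector X A ` space M" for x
  proof -
    have "subvector X A -` {x} \<inter> space M = {\<omega> \<in> space M. \<forall>i\<in>A. X i \<omega> = x i}"
      using that by (auto simp: subvector_def fun_eq_iff restrict_def) metis
    also have "\<dots> = space M \<inter> (\<Inter>i\<in>A. X i -` {x i} \<inter> space M) \<union> (if A = {} then space M else {})"
      by auto
    also have "\<dots> \<in> sets M"
    proof (cases "A = {}")
      case False
      have "(\<Inter>i\<in>A. X i -` {x i} \<inter> space M) \<in> sets M"
        using assms False by (intro sets.finite_INT) (auto intro: simple_functionD)
      then show ?thesis using False by auto
    qed simp
    finally show ?thesis .
  qed
  show ?thesis using fin meas by (auto simp: simple_function_def)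
qed

lemma joint_entropy_eq:
  assumes "prob_space M" "\<And>i. simple_function M (X i)"
  shows "joint_entropy M X A = - (\<Sum>x\<in>subvector X A ` space M.
    measure M (subvector X A -` {x} \<inter> space M) *
      log 2 (measure M (subvector X A -` {x} \<inter> space M)))"
proof -
  interpret information_space M 2
    using assms(1) by (simp add: information_space_def information_space_axioms_def)
  have "simple_distributed M (subvector X A)
      (\<lambda>x. measure M (subvector X A -` {x} \<inter> space M))"
    by (rule simple_distributedI[OF simple_function_subvector]) (use assms in auto)
  from entropy_simple_distributed[OF this] show ?thesis
    by (simp add: joint_entropy_def)
qed

lemma entropic_if_entropy_vector_of:
  fixes M :: "'w measure" and X :: "4 \<Rightarrow> 'w \<Rightarrow> 'v"
  assumes "entropy_vector_of M X h"
  shows "entropic h"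
proof -
  have ps: "prob_space M" and sf: "\<And>i. simple_function M (X i)"
    and h: "\<And>A. h $ A = joint_entropy M X A"
    using assms by (auto simp: entropy_vector_of_def)
  interpret prob_space M by fact
  define V where "V = (\<Union>i. X i ` space M)"
  have "finite V"
    using sf by (auto simp: V_def simple_function_def)
  then obtain e :: "'v \<Rightarrow> nat" where e: "inj_on e V"
    using finite_imp_inj_to_nat_seg by blast
  define Z where "Z = (\<lambda>\<omega> i. e (X i \<omega>))"
  define S where "S = Z ` space M"
  define N where "N = distr M (count_space S) Z"
  have Zfun: "Z = subvector (\<lambda>i. e \<circ> X i) UNIV"
    by (simp add: Z_def subvector_def fun_eq_iff)
  have sfZ: "simple_function M Z"
    unfolding Zfun by (rule simple_function_subvector) (rule simple_function_compose[OF sf])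
  have Zm: "Z \<in> measurable M (count_space S)"
    using sfZ by (auto simp: S_def simple_function_def measurable_count_space_eq2)
  have psN: "prob_space N"
    unfolding N_def by (rule prob_space_distr[OF Zm])
  have spN: "space N = S" and setsN: "sets N = Pow S"
    by (auto simp: N_def)
  have finS: "finite S" using sfZ by (simp add: S_def simple_function_def)
  define Y where "Y = (\<lambda>(i::4) (f::4 \<Rightarrow> nat). f i)"
  have sfY: "simple_function N (Y i)" for i
    using finS by (auto simp: simple_function_def spN setsN)
  have "joint_entropy N Y A = joint_entropy M X A" for A
  proof -
    define g where "g = (\<lambda>f::4 \<Rightarrow> 'v. restrict (\<lambda>i. e (f i)) A)"
    have sub: "subvector Y A (Z \<omega>) = g (subvector X A \<omega>)" for \<omega>
      by (auto simp: subvector_def g_def Y_def Z_def)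
    have img: "subvector Y A ` space N = g ` subvector X A ` space M"
      using sub by (auto simp: spN S_def image_iff)
    have inj: "inj_on g (subvector X A ` space M)"
    proof (rule inj_onI)
      fix x y assume x: "x \<in> subvector X A ` space M" and y: "y \<in> subvector X A ` space M"
        and eq: "g x = g y"
      obtain u v where uv: "x = subvector X A u" "y = subvector X A v" "u \<in> space M" "v \<in> space M"
        using x y by auto
      have "X i u = X i v" if "i \<in> A" for i
      proof -
        have "e (X i u) = e (X i v)"
          using fun_cong[OF eq, of i] that uv by (simp add: g_def subvector_def)
        moreover have "X i u \<in> V" "X i v \<in> V" using uv by (auto simp: V_def)
        ultimately show ?thesis using e by (auto dest: inj_onD)
      qed
      then show "x = y" using uv by (auto simp: subvector_def fun_eq_iff restrict_def)
    qed
    have meas: "measure N (subvector Y A -` {g x} \<inter> space N) =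
        measure M (subvector X A -` {x} \<inter> space M)" if "x \<in> subvector X A ` space M" for x
    proof -
      have "measure N (subvector Y A -` {g x} \<inter> space N) =
          measure M (Z -` (subvector Y A -` {g x} \<inter> S) \<inter> space M)"
        unfolding spN unfolding N_def by (rule measure_distr[OF Zm]) auto
      also have "Z -` (subvector Y A -` {g x} \<inter> S) \<inter> space M = subvector X A -` {x} \<inter> space M"
      proof -
        have "Z \<omega> \<in> S \<and> subvector Y A (Z \<omega>) = g x \<longleftrightarrow> subvector X A \<omega> = x"
          if "\<omega> \<in> space M" for \<omega>
          using inj_on_eq_iff[OF inj, of "subvector X A \<omega>" x] that
            \<open>x \<in> subvector X A ` space M\<close>
          by (auto simp: S_def sub)
        then show ?thesis by auto
      qed
      finally show ?thesis .
    qed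
    show ?thesis
      unfolding joint_entropy_eq[OF psN sfY] joint_entropy_eq[OF ps sf] img
      by (simp add: sum.reindex[OF inj] meas)
  qed
  then have "entropy_vector_of N Y h"
    using psN sfY h by (simp add: entropy_vector_of_def)
  then show ?thesis
    unfolding entropic_def by blast
qed

lemma subset_4_cases:
  fixes A :: "4 set"
  shows "A \<in> {{}, {0}, {1}, {2}, {3}, {0,1}, {0,2}, {0,3}, {1,2}, {1,3}, {2,3},
    {0,1,2}, {0,1,3}, {0,2,3}, {1,2,3}, UNIV}"
proof -
  have U: "(UNIV :: 4 set) = {0, 1, 2, 3}"
    unfolding ground_set by auto
  then have "A \<in> Pow {0, 1, 2, 3}" by auto
  then have "A \<in> {{}, {0}, {1}, {2}, {3}, {0,1}, {0,2}, {0,3}, {1,2}, {1,3}, {2,3},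
    {0,1,2}, {0,1,3}, {0,2,3}, {1,2,3}, {0,1,2,3}}"
    by (simp only: Pow_insert Pow_empty image_insert image_empty Un_insert_left Un_empty_left
        insert_iff empty_iff) (elim disjE FalseE; simp only: simp_thms)
  then show ?thesis unfolding U .
qed

lemma uniform_rank_in_Gamma4: "uniform_rank k \<in> Gamma4"
proof -
  have "min k (card (A \<union> B)) + min k (card (A \<inter> B)) \<le> min k (card A) + min k (card B)" for A B :: "4 set"
  proof -
    have "card A + card B = card (A \<union> B) + card (A \<inter> B)" by (rule card_Un_Int) auto
    moreover have "card (A \<inter> B) \<le> card A" "card (A \<inter> B) \<le> card B"
      "card A \<le> card (A \<union> B)" "card B \<le> card (A \<union> B)" by (auto intro: card_mono)
    ultimately show ?thesis by linarith
  qed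
  moreover have "min k (card A) \<le> min k (card B)" if "A \<subseteq> B" for A B :: "4 set"
    using card_mono[OF _ that] by (simp add: min_le_iff_disj)
  ultimately show ?thesis
    unfolding Gamma4_def uniform_rank_def
    by (auto simp del: of_nat_min simp flip: of_nat_add)
qed

lemma Gamma4_comb:
  assumes "x \<in> Gamma4" "y \<in> Gamma4" "0 \<le> a" "0 \<le> b"
  shows "a *\<^sub>R x + b *\<^sub>R y \<in> Gamma4"
proof -
  have "a * x $ (A \<union> B) + b * y $ (A \<union> B) + (a * x $ (A \<inter> B) + b * y $ (A \<inter> B))
      \<le> a * x $ A + b * y $ A + (a * x $ B + b * y $ B)" for A B
  proof -
    have "a * (x $ (A \<union> B) + x $ (A \<inter> B)) \<le> a * (x $ A + x $ B)"
      "b * (y $ (A \<union> B) + y $ (A \<inter> B)) \<le> b * (y $ A + y $ B)"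
      using assms by (auto simp: Gamma4_def intro!: mult_left_mono)
    then show ?thesis by (simp add: algebra_simps)
  qed
  then show ?thesis
    using assms by (auto simp: Gamma4_def intro!: add_mono mult_left_mono)
qed

lemma pair_face_uniform_iff:
  "h \<in> pair_face (uniform_rank 3) (uniform_rank 1) \<longleftrightarrow>
    h \<in> Gamma4 \<and>
    (\<forall>A B. card A = 2 \<and> card B = 2 \<and> card (A \<inter> B) = 1 \<longrightarrow>
      h $ A + h $ B = h $ (A \<union> B) + h $ (A \<inter> B)) \<and>
    (\<forall>A. card A = 3 \<longrightarrow> h $ A = h $ UNIV)" (is "_ \<longleftrightarrow> ?R")
proof
  assume "h \<in> pair_face (uniform_rank 3) (uniform_rank 1)"
  then obtain a b where h: "h = a *\<^sub>R uniform_rank 3 + b *\<^sub>R uniform_rank 1" and ab: "0 \<le> a" "0 \<le> b"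
    by (auto simp: pair_face_def pair_point_def)
  have "card (A \<union> B) = 3" if "card A = 2" "card B = 2" "card (A \<inter> B) = 1" for A B :: "4 set"
    using card_Un_Int[of A B] that by simp
  then show ?R
    using Gamma4_comb[OF uniform_rank_in_Gamma4 uniform_rank_in_Gamma4 ab]
    by (auto simp: h uniform_rank_def)
next
  assume R: ?R
  have G: "h \<in> Gamma4" and e: "h $ {} = 0"
    using R by (auto simp: Gamma4_def)
  have pair: "h $ {i,k} + h $ {j,k} = h $ {i,j,k} + h $ {k}"
    if "i \<noteq> j" "i \<noteq> k" "j \<noteq> k" for i j k
  proof -
    have "{i,k} \<inter> {j,k} = {k}" "{i,k} \<union> {j,k} = {i,j,k}" using that by auto
    then show ?thesis using R that by (metis card_2_iff is_singletonI is_singleton_altdef)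
  qed
  have triple: "h $ {i,j,k} = h $ UNIV" if "i \<noteq> j" "i \<noteq> k" "j \<noteq> k" for i j k
    using R that by simp
  have eq: "h $ {i,k} + h $ {j,k} = h $ UNIV + h $ {k}"
    if "i \<noteq> j" "i \<noteq> k" "j \<noteq> k" for i j k
    using pair[OF that] triple[OF that] by simp
  have d: "(0::4) \<noteq> 1" "(0::4) \<noteq> 2" "(0::4) \<noteq> 3" "(1::4) \<noteq> 2" "(1::4) \<noteq> 3" "(2::4) \<noteq> 3"
    by simp_all
  define a where "a = h $ {0,1} - h $ {0}"
  define b where "b = 2 * h $ {0} - h $ {0,1}"
  have c: "{1,0} = {0,1::4}" "{2,0} = {0,2::4}" "{3,0} = {0,3::4}"
     "{2,1} = {1,2::4}" "{3,1} = {1,3::4}" "{3,2} = {2,3::4}" by auto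
  note eqs = eq[of 1 2 0] eq[of 1 3 0] eq[of 2 3 0] eq[of 0 2 1] eq[of 0 3 1] eq[of 2 3 1]
    eq[of 0 1 2] eq[of 0 3 2] eq[of 1 3 2] eq[of 0 1 3] eq[of 0 2 3] eq[of 1 2 3]
  note eqs' = eqs[unfolded c, simplified]
  note tr = triple[of 0 1 2] triple[of 0 1 3] triple[of 0 2 3] triple[of 1 2 3]
  note tr' = tr[simplified]
  have P: "h $ {0,2} = h $ {0,1}" "h $ {0,3} = h $ {0,1}" "h $ {1,2} = h $ {0,1}"
    "h $ {1,3} = h $ {0,1}" "h $ {2,3} = h $ {0,1}"
    using eqs' by linarith+
  have S: "h $ {1} = h $ {0}" "h $ {2} = h $ {0}" "h $ {3} = h $ {0}"
    and U: "h $ UNIV = 2 * h $ {0,1} - h $ {0}"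
    using eqs' P by linarith+
  have "h $ {0} \<le> h $ {0,1}" using G by (auto simp: Gamma4_def)
  then have a0: "0 \<le> a" by (simp add: a_def)
  have "h $ ({0} \<union> {1}) + h $ ({0} \<inter> {1}) \<le> h $ {0} + h $ {1}" using G unfolding Gamma4_def by blast
  then have b0: "0 \<le> b" using S e by (simp add: b_def insert_commute)
  have "h $ A = a * real (min 3 (card A)) + b * real (min 1 (card A))" for A
    using subset_4_cases[of A] by (elim insertE emptyE)
      (simp_all add: e P S U tr' a_def b_def del: of_nat_min)
  then have "h = pair_point (uniform_rank 3) (uniform_rank 1) a b"
    by (simp add: vec_eq_iff pair_point_def uniform_rank_def)
  then show "h \<in> pair_face (uniform_rank 3) (uniform_rank 1)"
    using a0 b0 by (auto simp: pair_face_def)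
qed

lemma pair_face_uniform_face_of:
  "pair_face (uniform_rank 3) (uniform_rank 1) face_of Gamma4" (is "?F face_of _")
proof -
  have 1: "?F \<subseteq> Gamma4"
    using pair_face_uniform_iff by auto
  have 2: "convex ?F"
  proof (rule convexI)
    fix x y :: "real ^ (4 set)" and u v :: real
    assume "x \<in> ?F" "y \<in> ?F" and uv: "0 \<le> u" "0 \<le> v"
    then obtain a b c d where x: "x = pair_point (uniform_rank 3) (uniform_rank 1) a b"
      and y: "y = pair_point (uniform_rank 3) (uniform_rank 1) c d"
      and nn: "0 \<le> a" "0 \<le> b" "0 \<le> c" "0 \<le> d"
      by (auto simp: pair_face_def)
    have "u *\<^sub>R x + v *\<^sub>R y =
        pair_point (uniform_rank 3) (uniform_rank 1) (u * a + v * c) (u * b + v * d)"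
      by (simp add: x y pair_point_def algebra_simps)
    moreover have "0 \<le> u * a + v * c" "0 \<le> u * b + v * d" using nn uv by auto
    ultimately show "u *\<^sub>R x + v *\<^sub>R y \<in> ?F" by (auto simp: pair_face_def)
  qed
  have half: "x \<in> ?F"
    if xy: "x \<in> Gamma4" "y \<in> Gamma4" and z: "u *\<^sub>R x + v *\<^sub>R y \<in> ?F" and uv: "0 < u" "0 < v"
    for x y u v
  proof -
    have pos: "f = 0" if "u * f + v * g = 0" "0 \<le> f" "0 \<le> g" for f g :: real
      using that uv by (metis add_nonneg_eq_0_iff mult_eq_0_iff mult_nonneg_nonneg less_eq_real_def order_less_irrefl)
    have "x $ A + x $ B = x $ (A \<union> B) + x $ (A \<inter> B)"
      if "card A = 2" "card B = 2" "card (A \<inter> B) = 1" for A B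
    proof -
      have "x $ A + x $ B - (x $ (A \<union> B) + x $ (A \<inter> B)) = 0"
      proof (rule pos)
        show "u * (x $ A + x $ B - (x $ (A \<union> B) + x $ (A \<inter> B))) +
            v * (y $ A + y $ B - (y $ (A \<union> B) + y $ (A \<inter> B))) = 0"
          using z that unfolding pair_face_uniform_iff by (simp add: algebra_simps)
      qed (use xy in \<open>auto simp: Gamma4_def\<close>)
      then show ?thesis by simp
    qed
    moreover have "x $ A = x $ UNIV" if "card A = 3" for A
    proof -
      have "x $ UNIV - x $ A = 0"
      proof (rule pos)
        show "u * (x $ UNIV - x $ A) + v * (y $ UNIV - y $ A) = 0"
          using z that unfolding pair_face_uniform_iff by (simp add: algebra_simps)
      qed (use xy in \<open>auto simp: Gamma4_def\<close>)
      then show ?thesis by simp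
    qed
    ultimately show ?thesis using xy unfolding pair_face_uniform_iff by blast
  qed
  have 3: "x \<in> ?F \<and> y \<in> ?F"
    if "x \<in> Gamma4" "y \<in> Gamma4" "z \<in> ?F" "z \<in> open_segment x y" for x y z
  proof -
    obtain u where u: "0 < u" "u < 1" "z = (1 - u) *\<^sub>R x + u *\<^sub>R y"
      using \<open>z \<in> open_segment x y\<close> by (auto simp: in_segment)
    then show ?thesis
      using half[of x y "1 - u" u] half[of y x u "1 - u"] that by (simp add: add.commute)
  qed
  show ?thesis unfolding face_of_def using 1 2 3 by blast
qed

end

(*
  If b = 0, any three of the variables are independent and determine the fourth. Choosing values
  x0, x1, x2 of positive probability and completing them by a possible value x3, the probability
  of the completed vector is p0(x0) p2(x2) p3(x3) as well as p1(x1) p2(x2) p3(x3), hence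
  p0(x0) = p1(x1). So X_0 is uniform on its support, of some size v, and a = log v.

  Conversely, for an integer v >= 1 a uniform word of the code {y in (Z/v)^4 : sum y = 0}
  realizes (log v, 0). Choosing v at random (v = v_w with probability p_w) and revealing w in
  every coordinate realizes (sum_w p_w log v_w, H(p)). Taking v_0 large, p_0 = a / log v_0 small
  and all other v_w = 1, the mean is a, while the other weights can be spread so that H(p) takes
  any prescribed value b > 0.
*)
theory Submission
  imports Defs "HOL-Real_Asymp.Real_Asymp"
begin

section \<open>Equality in Gibbs' inequality, and finite expectations\<close>

text \<open>The inequality ln t <= t - 1 at t = q/p makes every \<open>d x\<close> nonnegative,
  while the hypotheses make their sum zero. So each \<open>d x\<close> vanishes, and equality in ln
  t <= t - 1 forces t = 1. Where p vanishes, \<open>d x\<close> is q x itself, so such points are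
  covered as well.\<close>

lemma gibbs_equality:
  fixes p q :: "'a \<Rightarrow> real"
  assumes "finite F"
    and p: "\<And>x. x \<in> F \<Longrightarrow> 0 \<le> p x" and q: "\<And>x. x \<in> F \<Longrightarrow> 0 \<le> q x"
    and ac: "\<And>x. x \<in> F \<Longrightarrow> 0 < p x \<Longrightarrow> 0 < q x"
    and sums: "sum p F = sum q F"
    and eq: "(\<Sum>x\<in>F. p x * log 2 (p x)) = (\<Sum>x\<in>F. p x * log 2 (q x))"
    and "x \<in> F"
  shows "p x = q x"
proof -
  define d where "d x = q x - p x - p x * (ln (q x) - ln (p x))" for x
  have pos_case: "p x * (ln (q x) - ln (p x)) = p x * ln (q x / p x)"
    "q x - p x = p x * (q x / p x - 1)" if "x \<in> F" "0 < p x" for x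
    using ac[OF that] that by (auto simp: ln_div field_simps)
  have d_nonneg: "0 \<le> d x" if x: "x \<in> F" for x
  proof (cases "p x = 0")
    case False
    with p[OF x] have px: "0 < p x" by simp
    then have "ln (q x / p x) \<le> q x / p x - 1"
      using ac[OF x] by (intro ln_le_minus_one) simp
    then have "p x * ln (q x / p x) \<le> p x * (q x / p x - 1)"
      using px by (intro mult_left_mono) auto
    then show ?thesis
      unfolding d_def using pos_case[OF x px] by linarith
  qed (use q[OF x] in \<open>simp add: d_def\<close>)
  have "(\<Sum>x\<in>F. p x * (ln (q x) - ln (p x))) =
      ln 2 * ((\<Sum>x\<in>F. p x * log 2 (q x)) - (\<Sum>x\<in>F. p x * log 2 (p x)))"
    by (simp add: log_def sum_distrib_left sum_subtractf[symmetric] right_diff_distrib)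
  then have "sum d F = 0"
    using sums eq by (simp add: d_def sum_subtractf)
  then have dx: "d x = 0"
    using sum_nonneg_eq_0_iff[OF \<open>finite F\<close> d_nonneg] \<open>x \<in> F\<close> by simp
  show ?thesis
  proof (cases "p x = 0")
    case True
    with dx show ?thesis by (simp add: d_def)
  next
    case False
    with p[OF \<open>x \<in> F\<close>] have px: "0 < p x" by simp
    have "p x * ln (q x / p x) = p x * (q x / p x - 1)"
      using dx pos_case[OF \<open>x \<in> F\<close> px] unfolding d_def by linarith
    then have "ln (q x / p x) = q x / p x - 1"
      using px by simp
    then have "q x / p x = 1"
      using px ac[OF \<open>x \<in> F\<close> px] by (intro ln_eq_minus_one) simp
    then show ?thesis using px by simp
  qed
qed

text \<open>F may exceed the range of Y: values that are not attained carry probability zero. This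
  allows summation over whole product boxes.\<close>

lemma expectation_finite_image:
  fixes g :: "'b \<Rightarrow> real"
  assumes "prob_space M" and Y: "simple_function M Y" and F: "finite F" "Y ` space M \<subseteq> F"
  shows "(\<integral>\<omega>. g (Y \<omega>) \<partial>M) = (\<Sum>y\<in>F. measure M {\<omega> \<in> space M. Y \<omega> = y} * g y)"
proof -
  interpret prob_space M by fact
  have sets: "{\<omega> \<in> space M. Y \<omega> = y} \<in> sets M" for y
  proof -
    have "{\<omega> \<in> space M. Y \<omega> = y} = Y -` {y} \<inter> space M" by auto
    then show ?thesis using simple_functionD(2)[OF Y, of "{y}"] by simp
  qed
  have "(\<integral>\<omega>. g (Y \<omega>) \<partial>M) = (\<integral>\<omega>. (\<Sum>y\<in>F. indicator {\<omega> \<in> space M. Y \<omega> = y} \<omega> * g y) \<partial>M)"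
  proof (rule Bochner_Integration.integral_cong)
    fix \<omega> assume \<omega>: "\<omega> \<in> space M"
    have "(\<Sum>y\<in>F. indicator {\<omega> \<in> space M. Y \<omega> = y} \<omega> * g y) =
        (\<Sum>y\<in>F. if Y \<omega> = y then g y else 0)"
      using \<omega> by (intro sum.cong) (auto simp: indicator_def)
    also have "\<dots> = g (Y \<omega>)"
      using \<omega> F by (subst sum.delta') auto
    finally show "g (Y \<omega>) = (\<Sum>y\<in>F. indicator {\<omega> \<in> space M. Y \<omega> = y} \<omega> * g y)" ..
  qed simp
  also have "\<dots> = (\<Sum>y\<in>F. measure M {\<omega> \<in> space M. Y \<omega> = y} * g y)"
    using sets by (subst Bochner_Integration.integral_sum)
      (auto simp: integrable_indicator_iff emeasure_eq_measure
        intro!: sum.cong arg_cong[where f="measure M"])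
  finally show ?thesis .
qed

section \<open>Joint probabilities and entropies of a finite random vector\<close>

text \<open>The point z is a total function of which only the values on A matter, so one z serves
  for the marginals of all index sets.\<close>

definition joint_prob :: "'w measure \<Rightarrow> (4 \<Rightarrow> 'w \<Rightarrow> 'v) \<Rightarrow> 4 set \<Rightarrow> (4 \<Rightarrow> 'v) \<Rightarrow> real" where
  "joint_prob M X A z = measure M {\<omega> \<in> space M. \<forall>i\<in>A. X i \<omega> = z i}"

lemma joint_prob_cong: "(\<And>i. i \<in> A \<Longrightarrow> z i = z' i) \<Longrightarrow> joint_prob M X A z = joint_prob M X A z'"
  by (simp add: joint_prob_def)

lemma joint_prob_nonneg: "0 \<le> joint_prob M X A z"
  by (simp add: joint_prob_def)

lemma subvector_eq_iff:
  "z \<in> extensional A \<Longrightarrow> subvector X A \<omega> = z \<longleftrightarrow> (\<forall>i\<in>A. X i \<omega> = z i)"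
  by (auto simp: subvector_def fun_eq_iff restrict_def extensional_def)

lemma subvector_extensional: "subvector X A \<omega> \<in> extensional A"
  by (simp add: subvector_def)

locale simple_random_vector = prob_space M for M :: "'w measure" +
  fixes X :: "4 \<Rightarrow> 'w \<Rightarrow> 'v"
  assumes sf: "\<And>i. simple_function M (X i)"
begin

lemma agreement_event_sets [measurable]: "{\<omega> \<in> space M. \<forall>i\<in>A. X i \<omega> = z i} \<in> sets M"
proof -
  have "{\<omega> \<in> space M. \<forall>i\<in>A. X i \<omega> = z i} = subvector X A -` {restrict z A} \<inter> space M"
    by (auto simp: subvector_eq_iff)
  then show ?thesis
    using simple_functionD(2)[OF simple_function_subvector[of M X A, OF sf], of "{restrict z A}"]
    by simp
qed

lemma joint_prob_antimono: "A \<subseteq> B \<Longrightarrow> joint_prob M X B z \<le> joint_prob M X A z"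
  unfolding joint_prob_def by (intro finite_measure_mono agreement_event_sets) auto

lemma expectation_subvector:
  fixes g :: "(4 \<Rightarrow> 'v) \<Rightarrow> real"
  shows "(\<integral>\<omega>. g (subvector X A \<omega>) \<partial>M) =
    (\<Sum>z\<in>(\<Pi>\<^sub>E i\<in>A. X i ` space M). joint_prob M X A z * g z)"
proof -
  have "(\<integral>\<omega>. g (subvector X A \<omega>) \<partial>M) =
      (\<Sum>z\<in>(\<Pi>\<^sub>E i\<in>A. X i ` space M). measure M {\<omega> \<in> space M. subvector X A \<omega> = z} * g z)"
    using sf by (intro expectation_finite_image prob_space_axioms simple_function_subvector finite_PiE)
      (auto simp: subvector_def simple_function_def)
  also have "\<dots> = (\<Sum>z\<in>(\<Pi>\<^sub>E i\<in>A. X i ` space M). joint_prob M X A z * g z)"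
    unfolding joint_prob_def
    by (rule sum.cong) (auto simp: PiE_def subvector_eq_iff)
  finally show ?thesis .
qed

text \<open>Entropy as the mean of -log of the probability of the observed value: the entropies of
  all index sets become integrals over one space.\<close>

lemma joint_entropy_eq_expectation:
  "joint_entropy M X A = - (\<integral>\<omega>. log 2 (joint_prob M X A (\<lambda>i. X i \<omega>)) \<partial>M)"
proof -
  have "(\<integral>\<omega>. log 2 (joint_prob M X A (\<lambda>i. X i \<omega>)) \<partial>M) =
      (\<integral>\<omega>. log 2 (joint_prob M X A (subvector X A \<omega>)) \<partial>M)"
    by (intro Bochner_Integration.integral_cong refl arg_cong[where f="log 2"] joint_prob_cong)
      (simp add: subvector_def)
  also have "\<dots> = (\<Sum>x\<in>subvector X A ` space M. measure M {\<omega> \<in> space M. subvector X A \<omega> = x} *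
      log 2 (joint_prob M X A x))"
    by (intro expectation_finite_image prob_space_axioms simple_function_subvector sf simple_functionD(1) order_refl)
  also have "\<dots> = (\<Sum>x\<in>subvector X A ` space M. measure M (subvector X A -` {x} \<inter> space M) *
      log 2 (measure M (subvector X A -` {x} \<inter> space M)))"
    unfolding joint_prob_def
    by (intro sum.cong refl arg_cong2[where f="(*)"] arg_cong[where f="log 2"]
        arg_cong[where f="measure M"])
      (auto simp: subvector_eq_iff subvector_extensional)
  finally show ?thesis
    unfolding joint_entropy_eq[of M X, OF prob_space_axioms sf] by simp
qed

text \<open>The logarithm depends only on the coordinates in A, so its mean may be taken under the
  law of the larger vector X_B. Entropies of A and B can then be compared term by term.\<close>

lemma joint_entropy_eq_sum:
  assumes "A \<subseteq> B"
  shows "joint_entropy M X A =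
    - (\<Sum>z\<in>(\<Pi>\<^sub>E i\<in>B. X i ` space M). joint_prob M X B z * log 2 (joint_prob M X A z))"
proof -
  have "(\<integral>\<omega>. log 2 (joint_prob M X A (\<lambda>i. X i \<omega>)) \<partial>M) =
      (\<integral>\<omega>. log 2 (joint_prob M X A (subvector X B \<omega>)) \<partial>M)"
    using assms
    by (intro Bochner_Integration.integral_cong refl arg_cong[where f="log 2"] joint_prob_cong)
      (auto simp: subvector_def)
  then show ?thesis
    using expectation_subvector[of "\<lambda>z. log 2 (joint_prob M X A z)" B]
    by (simp add: joint_entropy_eq_expectation)
qed

lemma sum_joint_prob: "(\<Sum>z\<in>(\<Pi>\<^sub>E i\<in>A. X i ` space M). joint_prob M X A z) = 1"
  using expectation_subvector[of "\<lambda>_. 1" A] prob_space by simp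

lemma sum_joint_prob_single: "(\<Sum>x\<in>X i ` space M. joint_prob M X {i} (\<lambda>_. x)) = 1"
proof -
  have "(\<integral>\<omega>. 1 \<partial>M) = (\<Sum>x\<in>X i ` space M. measure M {\<omega> \<in> space M. X i \<omega> = x} * 1)"
    using sf by (intro expectation_finite_image prob_space_axioms) (auto simp: simple_function_def)
  then show ?thesis using prob_space by (simp add: joint_prob_def)
qed

lemma joint_entropy_single:
  "joint_entropy M X {i} = - (\<Sum>x\<in>X i ` space M.
    joint_prob M X {i} (\<lambda>_. x) * log 2 (joint_prob M X {i} (\<lambda>_. x)))"
proof -
  have "(\<integral>\<omega>. log 2 (joint_prob M X {i} (\<lambda>j. X j \<omega>)) \<partial>M) =
      (\<integral>\<omega>. log 2 (joint_prob M X {i} (\<lambda>_. X i \<omega>)) \<partial>M)"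
    by (intro Bochner_Integration.integral_cong refl arg_cong[where f="log 2"] joint_prob_cong) simp
  also have "\<dots> = (\<Sum>x\<in>X i ` space M. measure M {\<omega> \<in> space M. X i \<omega> = x} *
      log 2 (joint_prob M X {i} (\<lambda>_. x)))"
    using sf by (intro expectation_finite_image prob_space_axioms) (auto simp: simple_function_def)
  finally show ?thesis
    unfolding joint_entropy_eq_expectation by (simp add: joint_prob_def)
qed

lemma joint_prob_pos_in_range:
  assumes "0 < joint_prob M X A z" "i \<in> A"
  shows "z i \<in> X i ` space M"
proof (rule ccontr)
  assume "z i \<notin> X i ` space M"
  then have "{\<omega> \<in> space M. \<forall>i\<in>A. X i \<omega> = z i} = {}" using \<open>i \<in> A\<close> by force
  then show False using assms(1) unfolding joint_prob_def by (metis measure_empty order_less_irrefl)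
qed

section \<open>Independence and functional dependence from entropy equalities\<close>

text \<open>Additivity of the entropies says that the divergence between the law of X_A and the
  product of its marginals is zero, so \<open>gibbs_equality\<close> identifies the two.\<close>

lemma joint_prob_eq_prod:
  assumes H: "joint_entropy M X A = (\<Sum>i\<in>A. joint_entropy M X {i})"
    and "\<And>i. i \<in> A \<Longrightarrow> z i \<in> X i ` space M"
  shows "joint_prob M X A z = (\<Prod>i\<in>A. joint_prob M X {i} z)"
proof -
  let ?F = "\<Pi>\<^sub>E i\<in>A. X i ` space M"
  have fin: "finite (X i ` space M)" for i using sf by (auto simp: simple_function_def)
  have ac: "0 < joint_prob M X {i} w" if "0 < joint_prob M X A w" "i \<in> A" for w i
    using joint_prob_antimono[of "{i}" A w] that by simp
  \<comment> \<open>The box contains only extensional functions; restricting z changes none of the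
    probabilities.\<close>
  have "joint_prob M X A (restrict z A) = (\<Prod>i\<in>A. joint_prob M X {i} (restrict z A))"
  proof (rule gibbs_equality[where F = ?F])
    show "finite ?F" using fin by (intro finite_PiE) auto
    have "(\<Sum>w\<in>?F. \<Prod>i\<in>A. joint_prob M X {i} w) =
        (\<Sum>w\<in>?F. \<Prod>i\<in>A. joint_prob M X {i} (\<lambda>_. w i))"
      by (intro sum.cong prod.cong refl joint_prob_cong) simp
    also have "\<dots> = (\<Prod>i\<in>A. \<Sum>x\<in>X i ` space M. joint_prob M X {i} (\<lambda>_. x))"
      using fin by (subst prod_sum_PiE) auto
    finally show "sum (joint_prob M X A) ?F = (\<Sum>w\<in>?F. \<Prod>i\<in>A. joint_prob M X {i} w)"
      by (simp add: sum_joint_prob sum_joint_prob_single)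
    have "(\<Sum>w\<in>?F. joint_prob M X A w * log 2 (\<Prod>i\<in>A. joint_prob M X {i} w)) =
        (\<Sum>w\<in>?F. \<Sum>i\<in>A. joint_prob M X A w * log 2 (joint_prob M X {i} w))"
    proof (rule sum.cong)
      fix w
      show "joint_prob M X A w * log 2 (\<Prod>i\<in>A. joint_prob M X {i} w) =
          (\<Sum>i\<in>A. joint_prob M X A w * log 2 (joint_prob M X {i} w))"
      \<comment> \<open>The logarithm of the product splits when all factors are positive, which
        \<open>ac\<close> yields where the joint probability is positive; elsewhere the weight is
        zero.\<close>
      proof (cases "joint_prob M X A w = 0")
        case False
        then have "0 < joint_prob M X A w" using joint_prob_nonneg[of M X A w] by simp
        then have "ln (\<Prod>i\<in>A. joint_prob M X {i} w) = (\<Sum>i\<in>A. ln (joint_prob M X {i} w))"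
          by (intro ln_prod) (auto dest: ac)
        then show ?thesis
          by (simp add: log_def sum_distrib_left sum_divide_distrib)
      qed simp
    qed simp
    also have "\<dots> = (\<Sum>i\<in>A. \<Sum>w\<in>?F. joint_prob M X A w * log 2 (joint_prob M X {i} w))"
      by (rule sum.swap)
    also have "\<dots> = (\<Sum>i\<in>A. - joint_entropy M X {i})"
      by (intro sum.cong refl) (simp add: joint_entropy_eq_sum[where B = A])
    finally show "(\<Sum>w\<in>?F. joint_prob M X A w * log 2 (joint_prob M X A w)) =
        (\<Sum>w\<in>?F. joint_prob M X A w * log 2 (\<Prod>i\<in>A. joint_prob M X {i} w))"
      using H by (simp add: joint_entropy_eq_sum[where A = A and B = A] sum_negf)
  qed (use assms(2) in \<open>auto intro: joint_prob_nonneg prod_nonneg ac prod_pos\<close>)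
  moreover have "joint_prob M X A (restrict z A) = joint_prob M X A z"
    by (rule joint_prob_cong) simp
  moreover have "(\<Prod>i\<in>A. joint_prob M X {i} (restrict z A)) = (\<Prod>i\<in>A. joint_prob M X {i} z)"
    by (intro prod.cong refl joint_prob_cong) simp
  ultimately show ?thesis by simp
qed

text \<open>The hypothesis says H(X_B | X_A) = 0. This conditional entropy is the sum of the terms
  \<open>?d w\<close>, which are nonnegative by monotonicity of probability, so each of them
  vanishes: almost surely X_A determines X_B.\<close>

lemma joint_prob_eq_if_joint_entropy_eq:
  assumes "A \<subseteq> B" and H: "joint_entropy M X A = joint_entropy M X B"
    and pos: "0 < joint_prob M X B z"
  shows "joint_prob M X B z = joint_prob M X A z"
proof -
  let ?F = "\<Pi>\<^sub>E i\<in>B. X i ` space M"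
  let ?d = "\<lambda>w. joint_prob M X B w * (log 2 (joint_prob M X A w) - log 2 (joint_prob M X B w))"
  have nonneg: "0 \<le> ?d w" for w
  proof (cases "joint_prob M X B w = 0")
    case False
    then have "0 < joint_prob M X B w" using joint_prob_nonneg[of M X B w] by simp
    then show ?thesis
      using joint_prob_antimono[OF \<open>A \<subseteq> B\<close>, of w] by (intro mult_nonneg_nonneg) auto
  qed simp
  have "sum ?d ?F = 0"
    using H unfolding joint_entropy_eq_sum[OF \<open>A \<subseteq> B\<close>] joint_entropy_eq_sum[OF order_refl, of B]
    by (simp add: right_diff_distrib sum_subtractf)
  moreover have "finite ?F" using sf by (intro finite_PiE) (auto simp: simple_function_def)
  moreover have "restrict z B \<in> ?F" using joint_prob_pos_in_range[OF pos] by auto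
  ultimately have "?d (restrict z B) = 0"
    using nonneg by (subst (asm) sum_nonneg_eq_0_iff) auto
  moreover have "joint_prob M X B (restrict z B) = joint_prob M X B z"
    "joint_prob M X A (restrict z B) = joint_prob M X A z"
    using \<open>A \<subseteq> B\<close> by (auto intro!: joint_prob_cong)
  ultimately have "log 2 (joint_prob M X A z) = log 2 (joint_prob M X B z)"
    using pos by simp
  then show ?thesis
    using pos joint_prob_antimono[OF \<open>A \<subseteq> B\<close>, of z] by (simp add: log_def)
qed

section \<open>Uniform marginals in the case b = 0\<close>

text \<open>The event on A is covered by finitely many events, one for each value of X j; by the
  union bound one of them has positive probability.\<close>

lemma joint_prob_extend:
  assumes pos: "0 < joint_prob M X A z" and "j \<notin> A"
  obtains x where "0 < joint_prob M X (insert j A) (z(j := x))"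
proof -
  let ?E = "\<lambda>x. {\<omega> \<in> space M. \<forall>i\<in>insert j A. X i \<omega> = (z(j := x)) i}"
  have "{\<omega> \<in> space M. \<forall>i\<in>A. X i \<omega> = z i} \<subseteq> (\<Union>x\<in>X j ` space M. ?E x)"
    using \<open>j \<notin> A\<close> by auto
  then have "joint_prob M X A z \<le> measure M (\<Union>x\<in>X j ` space M. ?E x)"
    unfolding joint_prob_def using sf agreement_event_sets
    by (intro finite_measure_mono sets.finite_UN) (auto simp only: simple_function_def)
  also have "\<dots> \<le> (\<Sum>x\<in>X j ` space M. joint_prob M X (insert j A) (z(j := x)))"
    unfolding joint_prob_def using sf agreement_event_sets
    by (intro finite_measure_subadditive_finite) (auto simp only: simple_function_def)
  finally have "0 < (\<Sum>x\<in>X j ` space M. joint_prob M X (insert j A) (z(j := x)))"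
    using pos by simp
  then show ?thesis
    using that joint_prob_nonneg by (metis less_eq_real_def sum_nonpos linorder_not_less)
qed

lemma single_prob_eq_if_triples_independent:
  assumes H: "\<And>A. joint_entropy M X A = a * real (min 3 (card A))"
    and pos: "0 < joint_prob M X {0} (\<lambda>_. x)" "0 < joint_prob M X {1} (\<lambda>_. y)"
  shows "joint_prob M X {0} (\<lambda>_. x) = joint_prob M X {1} (\<lambda>_. y)"
proof -
  \<comment> \<open>Three coordinates have entropy 3 a, the sum of their single entropies a; all
    four together still have only 3 a.\<close>
  have indep: "joint_prob M X A z = (\<Prod>i\<in>A. joint_prob M X {i} z)"
    if "card A = 3" "\<And>i. i \<in> A \<Longrightarrow> 0 < joint_prob M X {i} z" for A z
    using that joint_prob_pos_in_range[of "{i}" z i for i]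
    by (intro joint_prob_eq_prod) (auto simp: H)
  have determined: "joint_prob M X UNIV z = joint_prob M X A z"
    if "card A = 3" "0 < joint_prob M X UNIV z" for A z
    using that by (intro joint_prob_eq_if_joint_entropy_eq) (auto simp: H)
  obtain u where u: "0 < joint_prob M X {2} (\<lambda>_. u)"
    using sum_joint_prob_single[of 2] joint_prob_nonneg[of M X "{2}"]
    by (metis less_eq_real_def not_one_le_zero sum_nonpos)
  \<comment> \<open>The value u at coordinate 3 is a placeholder, overwritten by t below.\<close>
  define z where "z = (\<lambda>i::4. if i = 0 then x else if i = 1 then y else u)"
  have z: "joint_prob M X {0} z = joint_prob M X {0} (\<lambda>_. x)"
    "joint_prob M X {1} z = joint_prob M X {1} (\<lambda>_. y)"
    "joint_prob M X {2} z = joint_prob M X {2} (\<lambda>_. u)"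
    by (auto intro!: joint_prob_cong simp: z_def)
  have "0 < joint_prob M X {0,1,2} z"
    using pos u by (subst indep) (auto simp: z)
  moreover have "(3::4) \<notin> {0,1,2}" by simp
  ultimately obtain t where "0 < joint_prob M X (insert 3 {0,1,2}) (z(3 := t))"
    by (rule joint_prob_extend)
  moreover have "insert 3 {0,1,2} = (UNIV :: 4 set)"
    using subset_4_cases[of "UNIV"] unfolding ground_set by auto
  ultimately have full: "0 < joint_prob M X UNIV (z(3 := t))" by simp
  let ?z = "z(3 := t)"
  have single_pos: "0 < joint_prob M X {i} ?z" for i
    using full joint_prob_antimono[of "{i}" UNIV ?z] by simp
  \<comment> \<open>The probability of the full word is read off from the triples {0,2,3} and
    {1,2,3}; their common factors are positive and cancel.\<close>
  have "joint_prob M X {0} ?z * (joint_prob M X {2} ?z * joint_prob M X {3} ?z) =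
      joint_prob M X UNIV ?z"
    using determined[of "{0,2,3}", OF _ full] indep[of "{0,2,3}" ?z] single_pos by simp
  also have "\<dots> = joint_prob M X {1} ?z * (joint_prob M X {2} ?z * joint_prob M X {3} ?z)"
    using determined[of "{1,2,3}", OF _ full] indep[of "{1,2,3}" ?z] single_pos by simp
  finally have "joint_prob M X {0} ?z = joint_prob M X {1} ?z"
    using single_pos[of 2] single_pos[of 3] by simp
  moreover have "joint_prob M X {0} ?z = joint_prob M X {0} z"
    "joint_prob M X {1} ?z = joint_prob M X {1} z"
    by (auto intro!: joint_prob_cong)
  ultimately show ?thesis by (simp add: z)
qed

text \<open>Comparing every possible value of X 0 with one fixed value y of X 1 shows that X 0 is
  uniform on its support; v is the size of that support.\<close>

lemma log_of_nat_if_triples_independent: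
  assumes H: "\<And>A. joint_entropy M X A = a * real (min 3 (card A))"
  shows "\<exists>v::nat. v > 0 \<and> a = log 2 (real v)"
proof -
  obtain y where y: "0 < joint_prob M X {1} (\<lambda>_. y)"
    using sum_joint_prob_single[of 1] joint_prob_nonneg[of M X "{1}"]
    by (metis less_eq_real_def not_one_le_zero sum_nonpos)
  define c where "c = joint_prob M X {1} (\<lambda>_. y)"
  have "0 < c" using y by (simp add: c_def)
  let ?p = "\<lambda>x. joint_prob M X {0} (\<lambda>_. x)"
  \<comment> \<open>The range of X 0 may contain values of probability zero, hence the passage to
    the support.\<close>
  define T where "T = {x \<in> X 0 ` space M. 0 < ?p x}"
  have pc: "?p x = c" if "x \<in> T" for x
    unfolding c_def using single_prob_eq_if_triples_independent[OF H _ y] that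
    by (simp add: T_def)
  have sum_T: "(\<Sum>x\<in>X 0 ` space M. f x) = (\<Sum>x\<in>T. f x)"
    if "\<And>x. ?p x = 0 \<Longrightarrow> f x = 0" for f :: "'v \<Rightarrow> real"
    using sf that joint_prob_nonneg[of M X "{0}"]
    by (intro sum.mono_neutral_right) (auto simp: T_def simple_function_def less_le)
  have "(\<Sum>x\<in>T. ?p x) = 1"
    using sum_joint_prob_single[of 0] by (simp add: sum_T)
  then have card_T: "real (card T) * c = 1" by (simp add: pc)
  have "a = joint_entropy M X {0}" by (simp add: H)
  also have "\<dots> = - (\<Sum>x\<in>T. ?p x * log 2 (?p x))"
    unfolding joint_entropy_single by (subst sum_T) auto
  also have "\<dots> = - (real (card T) * c * log 2 c)" by (simp add: pc)
  also have "\<dots> = log 2 (1 / c)" using card_T \<open>0 < c\<close> by (simp add: log_divide)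
  also have "1 / c = real (card T)" using card_T \<open>0 < c\<close> by (simp add: field_simps)
  finally show ?thesis
    using card_T by (intro exI[of _ "card T"]) (auto intro: Nat.gr0I)
qed

end

section \<open>The parity code over Z/v\<close>

definition parity_code :: "nat \<Rightarrow> (4 \<Rightarrow> nat) set" where
  "parity_code v = {y. (\<forall>i. y i < v) \<and> v dvd (\<Sum>i\<in>UNIV. y i)}"

lemma finite_parity_code: "finite (parity_code v)"
proof (rule finite_subset)
  show "parity_code v \<subseteq> (\<Pi>\<^sub>E i\<in>UNIV. {..<v})" by (auto simp: parity_code_def)
qed (auto intro: finite_PiE)

text \<open>Solves the parity check for one coordinate when s is the sum of the other three.\<close>

lemma ex1_less_dvd_add:
  assumes "0 < (v::nat)"
  shows "\<exists>!t. t < v \<and> v dvd t + s"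
proof (rule ex_ex1I)
  \<comment> \<open>The witness is -s modulo v; adding v * s keeps it a natural number, as v >=
    1.\<close>
  have "((v * s - s) mod v + s) mod v = (v * s - s + s) mod v" by (simp add: mod_simps)
  also have "v * s - s + s = v * s" using assms by simp
  finally have "(v * s - s) mod v < v \<and> v dvd (v * s - s) mod v + s"
    using assms by (simp add: dvd_eq_mod_eq_0)
  then show "\<exists>t. t < v \<and> v dvd t + s" ..
next
  \<comment> \<open>Two solutions differ by a multiple of v that is smaller than v.\<close>
  have le: "t' \<le> t" if t: "t < v \<and> v dvd t + s" "t' < v \<and> v dvd t' + s" for t t'
  proof (rule ccontr)
    assume "\<not> t' \<le> t"
    moreover have "v dvd (t' + s) - (t + s)" using t by (intro dvd_diff_nat) auto
    ultimately show False using t nat_dvd_not_less[of "t' - t" v] by (simp add: less_imp_diff_less)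
  qed
  show "t = t'" if "t < v \<and> v dvd t + s" "t' < v \<and> v dvd t' + s" for t t'
    using le[OF that] le[OF that(2,1)] by simp
qed

text \<open>Some j outside A serves as check coordinate: the entries on the remaining set D are
  free, and the one at j is then forced. For A = \<open>UNIV\<close> the truncated exponent 3 - 4 =
  0 correctly counts z alone.\<close>

lemma card_parity_code_agree:
  assumes z: "z \<in> parity_code v"
  shows "card {y \<in> parity_code v. \<forall>i\<in>A. y i = z i} = v ^ (3 - card A)" (is "card ?S = _")
proof (cases "A = UNIV")
  case True
  then have "?S = {z}" using z by auto
  then show ?thesis using True by simp
next
  case False
  then obtain j where j: "j \<notin> A" by auto
  have "0 < v" using z by (auto simp: parity_code_def intro: Nat.gr0I)
  define D where "D = - insert j A"
  have card_D: "card D = 3 - card A"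
    using j by (simp add: D_def Compl_eq_Diff_UNIV card_Diff_subset)
  have split: "(\<Sum>i\<in>UNIV. y i) = y j + (\<Sum>i\<in>UNIV - {j}. y i)" for y :: "4 \<Rightarrow> nat"
    by (rule sum.remove) auto
  have "bij_betw (\<lambda>y. restrict y D) ?S (\<Pi>\<^sub>E i\<in>D. {..<v})"
  proof (rule bij_betwI')
    fix y y' assume y: "y \<in> ?S" and y': "y' \<in> ?S"
    show "restrict y D = restrict y' D \<longleftrightarrow> y = y'"
    proof
      assume eq: "restrict y D = restrict y' D"
      have off: "y i = y' i" if "i \<noteq> j" for i
        using fun_cong[OF eq, of i] y y' that by (cases "i \<in> A") (auto simp: D_def)
      then have "(\<Sum>i\<in>UNIV - {j}. y i) = (\<Sum>i\<in>UNIV - {j}. y' i)" by (intro sum.cong) auto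
      then have "y j = y' j"
        using y y' ex1_less_dvd_add[OF \<open>0 < v\<close>, of "\<Sum>i\<in>UNIV - {j}. y i"]
        by (auto simp: parity_code_def split)
      with off show "y = y'" by (metis ext)
    qed simp
  next
    fix y assume "y \<in> ?S"
    then show "restrict y D \<in> (\<Pi>\<^sub>E i\<in>D. {..<v})" by (auto simp: parity_code_def)
  next
    fix f assume f: "f \<in> (\<Pi>\<^sub>E i\<in>D. {..<v})"
    define w where "w i = (if i \<in> A then z i else f i)" for i
    obtain t where t: "t < v" "v dvd t + (\<Sum>i\<in>UNIV - {j}. w i)"
      using ex1_less_dvd_add[OF \<open>0 < v\<close>] by blast
    have "(\<Sum>i\<in>UNIV. (w(j := t)) i) = t + (\<Sum>i\<in>UNIV - {j}. w i)"
      unfolding split by simp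
    moreover have "(w(j := t)) i < v" for i
      using t z f by (auto simp: w_def parity_code_def D_def)
    ultimately have "w(j := t) \<in> ?S"
      using t j by (auto simp: parity_code_def w_def simp del: fun_upd_apply) (auto simp: w_def)
    moreover have "f = restrict (w(j := t)) D"
      using f by (auto simp: fun_eq_iff D_def w_def restrict_def PiE_def extensional_def)
    ultimately show "\<exists>y\<in>?S. f = restrict y D" by blast
  qed
  then show ?thesis
    by (simp add: bij_betw_same_card card_PiE card_D)
qed

lemma card_parity_code: "0 < v \<Longrightarrow> card (parity_code v) = v ^ 3"
  using card_parity_code_agree[of "\<lambda>_. 0" v "{}"] by (simp add: parity_code_def)

section \<open>Mixtures of parity codes\<close>

text \<open>Every nonempty A sees the index w, which contributes the entropy of p exactly once;
  given w, the entries on A are uniform over v_w^(min 3 |A|) possibilities, by the count of agreeing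
  code words.\<close>

lemma entropic_mixture:
  fixes p :: "nat \<Rightarrow> real" and v :: "nat \<Rightarrow> nat"
  assumes p: "\<And>w. w < n \<Longrightarrow> 0 \<le> p w" and sum_p: "(\<Sum>w<n. p w) = 1"
    and v: "\<And>w. w < n \<Longrightarrow> 0 < v w"
  shows "entropic (pair_point (uniform_rank 3) (uniform_rank 1)
    (\<Sum>w<n. p w * log 2 (real (v w))) (- (\<Sum>w<n. p w * log 2 (p w))))"
    (is "entropic (pair_point _ _ ?a ?b)")
proof -
  define S where "S = (SIGMA w:{..<n}. parity_code (v w))"
  \<comment> \<open>Given w, the word is uniform on a code of size v_w^3.\<close>
  define f where "f = (\<lambda>(w, y::4 \<Rightarrow> nat). p w / real (v w) ^ 3)"
  define M where "M = point_measure S (\<lambda>s. ennreal (f s))"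
  define X where "X i = (\<lambda>(w::nat, y::4 \<Rightarrow> nat). (w, y i))" for i
  have finS: "finite S" by (auto simp: S_def finite_parity_code)
  have f_nonneg: "0 \<le> f s" if "s \<in> S" for s
    using that p by (auto simp: S_def f_def)
  have sum_S: "(\<Sum>s\<in>S. f s * g (fst s)) = (\<Sum>w<n. p w * g w)" for g :: "nat \<Rightarrow> real"
  proof -
    have "(\<Sum>s\<in>S. f s * g (fst s)) = (\<Sum>w<n. \<Sum>y\<in>parity_code (v w). p w / real (v w) ^ 3 * g w)"
      unfolding S_def f_def by (subst sum.Sigma) (auto simp: finite_parity_code intro!: sum.cong)
    also have "\<dots> = (\<Sum>w<n. p w * g w)"
      using v by (intro sum.cong) (auto simp: card_parity_code)
    finally show ?thesis .
  qed
  have spM: "space M = S" and setsM: "sets M = Pow S"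
    by (auto simp: M_def space_point_measure sets_point_measure)
  have "(\<Sum>s\<in>S. f s) = 1" using sum_S[of "\<lambda>_. 1"] sum_p by simp
  then have ps: "prob_space M"
    unfolding M_def using finS f_nonneg
    by (intro prob_space_point_measure) (simp_all add: sum_ennreal)
  then interpret prob_space M .
  have sf: "simple_function M (X i)" for i
    using finS by (auto simp: simple_function_def spM setsM)
  interpret simple_random_vector M X by unfold_locales (rule sf)
  \<comment> \<open>An empty A does not see w and is treated separately in
    \<open>ent0\<close>.\<close>
  have jp: "joint_prob M X A (\<lambda>i. X i (w, y)) = p w / real (v w) ^ min 3 (card A)"
    if wy: "(w, y) \<in> S" and "A \<noteq> {}" for w y A
  proof -
    let ?C = "{y' \<in> parity_code (v w). \<forall>i\<in>A. y' i = y i}"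
    have "{s \<in> space M. \<forall>i\<in>A. X i s = X i (w, y)} = Pair w ` ?C"
      using wy \<open>A \<noteq> {}\<close> by (auto simp: spM S_def X_def image_iff)
    then have "joint_prob M X A (\<lambda>i. X i (w, y)) = measure M (Pair w ` ?C)"
      by (simp add: joint_prob_def)
    also have "\<dots> = (\<Sum>s\<in>Pair w ` ?C. f s)"
      unfolding M_def using wy finS f_nonneg
      by (subst measure_point_measure_finite_if) (auto simp: S_def)
    also have "\<dots> = real (card ?C) * (p w / real (v w) ^ 3)"
      by (subst sum.reindex) (auto simp: inj_on_def f_def)
    also have "\<dots> = real (v w) ^ (3 - card A) * (p w / real (v w) ^ 3)"
      using wy by (simp add: S_def card_parity_code_agree)
    \<comment> \<open>With truncated subtraction, (3 - |A|) + min 3 |A| = 3 also when |A| =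
      4.\<close>
    also have "real (v w) ^ 3 = real (v w) ^ (3 - card A) * real (v w) ^ min 3 (card A)"
      by (simp add: min_def flip: power_add)
    finally show ?thesis using v[of w] wy by (simp add: S_def)
  qed
  have ent: "joint_entropy M X A = ?b + real (min 3 (card A)) * ?a" if "A \<noteq> {}" for A
  proof -
    let ?m = "min 3 (card A)"
    have "joint_entropy M X A = - (\<Sum>s\<in>S. f s * log 2 (joint_prob M X A (\<lambda>i. X i s)))"
      unfolding joint_entropy_eq_expectation
      unfolding M_def using finS f_nonneg by (subst lebesgue_integral_point_measure_finite) auto
    also have "\<dots> = - (\<Sum>s\<in>S. f s * log 2 (p (fst s) / real (v (fst s)) ^ ?m))"
      using jp[OF _ that] by (intro arg_cong[where f=uminus] sum.cong) auto
    also have "\<dots> = - (\<Sum>w<n. p w * log 2 (p w / real (v w) ^ ?m))"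
      by (simp add: sum_S[of "\<lambda>w. log 2 (p w / real (v w) ^ ?m)"])
    also have "(\<Sum>w<n. p w * log 2 (p w / real (v w) ^ ?m)) =
        (\<Sum>w<n. p w * log 2 (p w) - real ?m * (p w * log 2 (real (v w))))"
    proof (rule sum.cong)
      fix w assume w: "w \<in> {..<n}"
      show "p w * log 2 (p w / real (v w) ^ ?m) =
          p w * log 2 (p w) - real ?m * (p w * log 2 (real (v w)))"
      proof (cases "p w = 0")
        case False
        then show ?thesis
          using p[of w] v[of w] w by (simp add: log_divide log_nat_power right_diff_distrib del: of_nat_min)
      qed simp
    qed simp
    finally show ?thesis
      by (simp add: sum_subtractf sum_distrib_left del: of_nat_min)
  qed
  have ent0: "joint_entropy M X {} = 0"
    unfolding joint_entropy_eq_expectation by (simp add: joint_prob_def prob_space)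
  have "pair_point (uniform_rank 3) (uniform_rank 1) ?a ?b $ A = joint_entropy M X A" for A
  proof (cases "A = {}")
    case False
    then have "min 1 (card A) = 1" using card_gt_0_iff[of A] by simp
    then show ?thesis
      using ent[OF False] by (simp add: pair_point_def uniform_rank_def del: of_nat_min)
  qed (simp add: ent0 pair_point_def uniform_rank_def)
  then have "entropy_vector_of M X (pair_point (uniform_rank 3) (uniform_rank 1) ?a ?b)"
    using ps sf by (simp add: entropy_vector_of_def)
  then show ?thesis by (rule entropic_if_entropy_vector_of)
qed

section \<open>Weights with prescribed mean and entropy when b > 0\<close>

definition entropy_term :: "real \<Rightarrow> real" where
  "entropy_term x = - (x * log 2 x)"

text \<open>At 0 only the one-sided limit of x log x matters; it is 0, the value that the factor x
  gives there.\<close>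

lemma continuous_on_entropy_term: "continuous_on {0..} entropy_term"
proof (rule continuous_on_eq_continuous_within[THEN iffD2], rule ballI)
  fix x :: real assume "x \<in> {0..}"
  show "continuous (at x within {0..}) entropy_term"
  proof (cases "x = 0")
    case True
    have "((\<lambda>x::real. - (x * log 2 x)) \<longlongrightarrow> 0) (at_right 0)" by real_asymp
    then show ?thesis
      using True at_within_Ici_at_right[of "0::real"]
      by (simp add: continuous_within entropy_term_def[abs_def])
  next
    case False
    then show ?thesis
      using \<open>x \<in> {0..}\<close> unfolding entropy_term_def[abs_def]
      by (intro continuous_intros continuous_at_imp_continuous_at_within) auto
  qed
qed

lemma entropy_term_nonneg: "0 \<le> x \<Longrightarrow> x \<le> 1 \<Longrightarrow> 0 \<le> entropy_term x"
  by (cases "x = 0") (auto simp: entropy_term_def mult_nonneg_nonpos)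

text \<open>Along q = a / log V the product q log V stays a while q tends to 0, so by continuity the
  binary entropy of q eventually falls below b. The bound 1/2 keeps half of the mass available for
  adjusting the entropy.\<close>

lemma ex_small_weight:
  assumes "0 \<le> a" "0 < b"
  obtains V :: nat and q :: real where "0 < V" "0 \<le> q" "q \<le> 1/2" "q * log 2 (real V) = a"
    "entropy_term q + entropy_term (1 - q) \<le> b"
proof -
  define q where "q V = a / log 2 (real V)" for V :: nat
  have lim: "q \<longlonglongrightarrow> 0" unfolding q_def[abs_def] by real_asymp
  have small: "\<forall>\<^sub>F V in sequentially. q V < 1/2" using order_tendstoD(2)[OF lim, of "1/2"] by simp
  have large: "\<forall>\<^sub>F V::nat in sequentially. 2 \<le> V" by (rule eventually_ge_at_top)
  have range: "\<forall>\<^sub>F V in sequentially. q V \<in> {0..1}"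
    using small large by eventually_elim (use \<open>0 \<le> a\<close> in \<open>auto simp: q_def\<close>)
  have "continuous_on {0..1} (\<lambda>x. entropy_term x + entropy_term (1 - x))"
    by (intro continuous_intros continuous_on_compose2[OF continuous_on_entropy_term]) auto
  from continuous_on_tendsto_compose[OF this lim _ range]
  have "(\<lambda>V. entropy_term (q V) + entropy_term (1 - q V)) \<longlonglongrightarrow> 0"
    by (simp add: entropy_term_def)
  then have "\<forall>\<^sub>F V in sequentially. entropy_term (q V) + entropy_term (1 - q V) < b"
    using order_tendstoD(2) \<open>0 < b\<close> by blast
  with small large have "\<forall>\<^sub>F V in sequentially.
      2 \<le> V \<and> q V < 1/2 \<and> entropy_term (q V) + entropy_term (1 - q V) < b"
    by eventually_elim auto
  then obtain V where V: "2 \<le> V" "q V < 1/2" "entropy_term (q V) + entropy_term (1 - q V) < b"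
    using eventually_happens by force
  show ?thesis
    by (rule that[of V "q V"]) (use V \<open>0 \<le> a\<close> in \<open>auto simp: q_def\<close>)
qed

text \<open>The mass 1 - q is split between one atom and k equal atoms in the proportion 1 - t to t.
  The entropy is continuous in t, at most b at t = 0 and at least b at t = 1, so the intermediate
  value theorem applies.\<close>

lemma ex_mixture_weights:
  assumes "0 \<le> a" "0 < b"
  obtains n :: nat and p :: "nat \<Rightarrow> real" and v :: "nat \<Rightarrow> nat"
  where "\<And>w. w < n \<Longrightarrow> 0 \<le> p w" "(\<Sum>w<n. p w) = 1" "\<And>w. w < n \<Longrightarrow> 0 < v w"
    "(\<Sum>w<n. p w * log 2 (real (v w))) = a" "- (\<Sum>w<n. p w * log 2 (p w)) = b"
proof -
  obtain V :: nat and q where V: "0 < V" and q: "0 \<le> q" "q \<le> 1/2" and a: "q * log 2 (real V) = a"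
    and low: "entropy_term q + entropy_term (1 - q) \<le> b"
    using ex_small_weight[OF assms] by blast
  \<comment> \<open>At t = 1 at least half of the mass is spread over k atoms, contributing at least
    (log k) / 2, so log k >= 2 b suffices.\<close>
  obtain k :: nat where k0: "2 powr (2 * b) \<le> real k" using real_arch_simple by blast
  then have kpos: "0 < real k" by (rule less_le_trans[rotated]) simp
  have k: "2 * b \<le> log 2 (real k)" using k0 kpos by (simp add: le_log_iff)
  define G where "G t = entropy_term q + entropy_term ((1 - q) * (1 - t)) +
    real k * entropy_term ((1 - q) * t / real k)" for t
  have "G 0 \<le> b" using low by (simp add: G_def entropy_term_def)
  moreover have "b \<le> G 1"
  proof -
    have "real k * entropy_term ((1 - q) / real k) =
        entropy_term (1 - q) + (1 - q) * log 2 (real k)"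
      using kpos q by (simp add: entropy_term_def log_divide field_simps)
    moreover have "1 / 2 * (2 * b) \<le> (1 - q) * log 2 (real k)"
      using k q \<open>0 < b\<close> by (intro mult_mono) auto
    ultimately show ?thesis
      using entropy_term_nonneg[of q] entropy_term_nonneg[of "1 - q"] q
      by (simp add: G_def entropy_term_def[of 0])
  qed
  moreover have "continuous_on {0..1} G"
    unfolding G_def[abs_def] using q kpos
    by (intro continuous_intros continuous_on_compose2[OF continuous_on_entropy_term]) auto
  ultimately obtain t where t: "0 \<le> t" "t \<le> 1" "G t = b"
    using IVT'[of G 0 b 1] by auto
  define p where "p w = (case w of 0 \<Rightarrow> q | Suc 0 \<Rightarrow> (1 - q) * (1 - t) | _ \<Rightarrow> (1 - q) * t / real k)"
    for w :: nat
  \<comment> \<open>Only index 0, of weight q, has a nontrivial code; the others have log 1 = 0 and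
    leave the mean at q log V = a.\<close>
  define v where "v w = (if w = 0 then V else 1)" for w :: nat
  have sums: "(\<Sum>w<Suc (Suc k). g w) = g 0 + g 1 + (\<Sum>w<k. g (Suc (Suc w)))"
    for g :: "nat \<Rightarrow> real"
    by (simp add: sum.lessThan_Suc_shift del: sum.lessThan_Suc)
  show ?thesis
  proof (rule that[of "Suc (Suc k)" p v])
    show "0 \<le> p w" for w using q t by (auto simp: p_def split: nat.split)
    show "(\<Sum>w<Suc (Suc k). p w) = 1"
      unfolding sums using kpos by (simp add: p_def field_simps)
    show "0 < v w" for w using V by (simp add: v_def)
    show "(\<Sum>w<Suc (Suc k). p w * log 2 (real (v w))) = a"
      unfolding sums using a by (simp add: p_def v_def)
    show "- (\<Sum>w<Suc (Suc k). p w * log 2 (p w)) = b"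
      unfolding sums t(3)[symmetric] by (simp add: p_def G_def entropy_term_def)
  qed
qed

theorem mainTheorem17:
  fixes a b :: real
  assumes "a \<ge> 0" and "b \<ge> 0"
  shows "entropic (pair_point (uniform_rank 3) (uniform_rank 1) a b) \<longleftrightarrow>
    (a \<ge> 0 \<and> b > 0) \<or> (\<exists>v::nat. v > 0 \<and> (a, b) = (log 2 (real v), 0))"
proof
  assume ent: "entropic (pair_point (uniform_rank 3) (uniform_rank 1) a b)"
  show "(a \<ge> 0 \<and> b > 0) \<or> (\<exists>v::nat. v > 0 \<and> (a, b) = (log 2 (real v), 0))"
  proof (cases "b = 0")
    case True
    obtain M :: "(4 \<Rightarrow> nat) measure" and X :: "4 \<Rightarrow> (4 \<Rightarrow> nat) \<Rightarrow> nat"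
      where "entropy_vector_of M X (pair_point (uniform_rank 3) (uniform_rank 1) a b)"
      using ent unfolding entropic_def by blast
    then have ps: "prob_space M" and sf: "\<And>i. simple_function M (X i)"
      and H: "\<And>A. joint_entropy M X A = a * real (min 3 (card A))"
      using True by (simp_all add: entropy_vector_of_def pair_point_def uniform_rank_def)
    interpret prob_space M by (rule ps)
    interpret simple_random_vector M X by unfold_locales (rule sf)
    show ?thesis
      using log_of_nat_if_triples_independent[OF H] True by simp
  qed (use assms in simp)
next
  assume "(a \<ge> 0 \<and> b > 0) \<or> (\<exists>v::nat. v > 0 \<and> (a, b) = (log 2 (real v), 0))"
  then show "entropic (pair_point (uniform_rank 3) (uniform_rank 1) a b)"
  proof (elim disjE exE conjE)
    assume "0 \<le> a" "0 < b"
    then obtain n :: nat and p :: "nat \<Rightarrow> real" and v :: "nat \<Rightarrow> nat"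
      where "\<And>w. w < n \<Longrightarrow> 0 \<le> p w" "(\<Sum>w<n. p w) = 1" "\<And>w. w < n \<Longrightarrow> 0 < v w"
        and a: "(\<Sum>w<n. p w * log 2 (real (v w))) = a"
        and b: "- (\<Sum>w<n. p w * log 2 (p w)) = b"
      using ex_mixture_weights by blast
    then show ?thesis
      using entropic_mixture[of n p v] unfolding a b by blast
  next
    \<comment> \<open>A single index of weight 1 has entropy 0 and mean log v.\<close>
    fix v :: nat assume "v > 0" "(a, b) = (log 2 (real v), 0)"
    then show ?thesis
      using entropic_mixture[of 1 "\<lambda>_. 1" "\<lambda>_. v"] by simp
  qed
qed

end
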